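(* For every integer $n \ge 1$, the number $h(n)$ of self-half-conjugate overpartitions of $n$ in which only even parts may be overlined equals $q(n)$, the number of partitions of $n$ into distinct parts.
   Context: An overpartition of $n$ is a partition of $n$ in which the first occurrence of each distinct part value may be overlined; it may be viewed as a pair $(\mu,\nu)$ where $\mu$ is the partition formed by the non-overlined parts and $\nu$ is the partition into distinct parts formed by the overlined parts, with $|\mu|+|\nu|=n$. Let $D_2(n)$ be the set of overpartitions of $n$ in which every overlined part is even (so $\nu$ consists of distinct even parts). The half-conjugate of an overpartition $(\mu,\nu)$ is the overpartition $(\mu',\nu)$, where $\mu'$ is the conjugate of the partition $\mu$ (overlined parts are kept fixed and the partition of non-overlined parts is conjugated). An overpartition is self-half-conjugate if it equals its half-conjugate, i.e. $\mu = \mu'$. $h(n)$ is the number of self-half-conjugate elements of $D_2(n)$. *)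

theory Defs
  imports Main "HOL-Library.Multiset"
begin

text \<open>A partition is the multiset of its (positive) parts.\<close>

definition partitions :: "nat \<Rightarrow> nat multiset set" where
  "partitions n = {\<mu>. 0 \<notin># \<mu> \<and> \<Sum>\<^sub># \<mu> = n}"

definition distinct_parts :: "nat multiset \<Rightarrow> bool" where
  "distinct_parts \<mu> \<longleftrightarrow> (\<forall>i. count \<mu> i \<le> 1)"

text \<open>Column \<open>j \<ge> 1\<close> of the Young diagram is nonempty iff some part is at least \<open>j\<close>,
  and its length is the number of parts that are at least \<open>j\<close>.\<close>

definition conjugate :: "nat multiset \<Rightarrow> nat multiset" where
  "conjugate \<mu> = {# size {# i \<in># \<mu>. j \<le> i #}. j \<in># mset_set {j. 1 \<le> j \<and> (\<exists>i\<in>#\<mu>. j \<le> i)} #}"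

text \<open>An overpartition is the pair of its non-overlined parts and its overlined parts.\<close>

type_synonym overpartition = "nat multiset \<times> nat multiset"

definition overpartitions :: "nat \<Rightarrow> overpartition set" where
  "overpartitions n =
     {(\<mu>, \<nu>). \<exists>k m. \<mu> \<in> partitions k \<and> \<nu> \<in> partitions m \<and> distinct_parts \<nu> \<and> k + m = n}"

definition D2 :: "nat \<Rightarrow> overpartition set" where
  "D2 n = {(\<mu>, \<nu>) \<in> overpartitions n. \<forall>i\<in>#\<nu>. even i}"

fun half_conjugate :: "overpartition \<Rightarrow> overpartition" where
  "half_conjugate (\<mu>, \<nu>) = (conjugate \<mu>, \<nu>)"

definition self_half_conjugate :: "overpartition \<Rightarrow> bool" where
  "self_half_conjugate \<pi> \<longleftrightarrow> half_conjugate \<pi> = \<pi>"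

definition h :: "nat \<Rightarrow> nat" where
  "h n = card {\<pi> \<in> D2 n. self_half_conjugate \<pi>}"

definition q :: "nat \<Rightarrow> nat" where
  "q n = card {\<mu> \<in> partitions n. distinct_parts \<mu>}"

end

theory Submission
  imports Defs "HOL-Library.Equipollence"
begin

text \<open>
  A self-conjugate partition with largest part \<open>a + 1\<close> arises from a unique self-conjugate
  partition with parts at most \<open>a\<close> by wrapping it in a hook with arm and leg \<open>a\<close>, which has
  \<open>2 a + 1\<close> cells. A partition into distinct odd parts with largest part \<open>2 a + 1\<close> arises from a
  unique such partition with parts below \<open>2 a\<close> by adding the part \<open>2 a + 1\<close>. By induction on
  \<open>a\<close>, self-conjugate partitions and partitions into distinct odd parts are equinumerous.
  Finally, a partition into distinct parts splits uniquely into its odd and its even parts.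
\<close>

section \<open>Wrapping a partition in a symmetric hook\<close>

text \<open>The hook is recorded row by row: its arm and corner form the new first row, each row of
  \<mu> gains one cell of the leg, and the leg cells below \<mu> become rows of length 1. The
  truncated \<open>a - size \<mu>\<close> counts these correctly when
  \<open>size \<mu> \<le> a\<close>.\<close>

definition wrap_hook :: "nat \<Rightarrow> nat multiset \<Rightarrow> nat multiset" where
  "wrap_hook a \<mu> = add_mset (Suc a) (image_mset Suc \<mu> + replicate_mset (a - size \<mu>) 1)"

lemma sum_mset_wrap_hook:
  assumes "size \<mu> \<le> a"
  shows "\<Sum>\<^sub># (wrap_hook a \<mu>) = \<Sum>\<^sub># \<mu> + (2 * a + 1)"
proof -
  have "\<Sum>\<^sub># (image_mset Suc \<mu>) = \<Sum>\<^sub># \<mu> + size \<mu>"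
    by (induction \<mu>) auto
  then show ?thesis
    using assms by (simp add: wrap_hook_def)
qed

lemma filter_mset_replicate_mset:
  "filter_mset P (replicate_mset m x) = (if P x then replicate_mset m x else {#})"
  by (induction m) auto

text \<open>The hook can be peeled off: remove the first row, shorten every other row by one cell
  and discard the empty rows. Since \<mu> has no zero parts, nothing of it is discarded.\<close>

lemma wrap_hook_inject:
  assumes "wrap_hook a \<mu> = wrap_hook a \<nu>" "0 \<notin># \<mu>" "0 \<notin># \<nu>"
  shows "\<mu> = \<nu>"
proof -
  have "filter_mset (\<lambda>i. i \<noteq> 0) (image_mset (\<lambda>i. i - 1) (wrap_hook a \<xi> - {#Suc a#})) = \<xi>"
    if "0 \<notin># \<xi>" for \<xi>
  proof -
    have "filter_mset (\<lambda>i. i \<noteq> 0) \<xi> = \<xi>"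
      by (rule multiset_eqI) (use that in \<open>auto simp: not_in_iff\<close>)
    then show ?thesis
      by (simp add: wrap_hook_def multiset.map_comp o_def filter_mset_replicate_mset)
  qed
  from this[OF assms(2)] this[OF assms(3)] assms(1) show ?thesis
    by metis
qed

text \<open>Describing the nonempty columns as an interval allows it to be shifted and cut later.
  Inserting 0 gives the empty partition the maximum 0, hence no columns.\<close>

lemma columns_eq:
  "{j. 1 \<le> j \<and> (\<exists>i\<in>#\<mu>. j \<le> i)} = {1..Max (insert 0 (set_mset \<mu>))}" for \<mu> :: "nat multiset"
  by (auto simp: Max_ge_iff)

lemma size_conjugate: "size (conjugate \<mu>) = Max (insert 0 (set_mset \<mu>))"
  unfolding conjugate_def columns_eq by simp

text \<open>Reflection in the diagonal maps the hook to itself, so it acts only on the partition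
  inside. The proof compares column lengths.\<close>

lemma conjugate_wrap_hook:
  assumes "\<forall>i\<in>#\<mu>. i \<le> a" "size \<mu> \<le> a"
  shows "conjugate (wrap_hook a \<mu>) = wrap_hook a (conjugate \<mu>)"
proof -
  define M where "M = Max (insert 0 (set_mset \<mu>))"
  have M: "M \<le> a" "\<forall>i\<in>#\<mu>. i \<le> M"
    using assms(1) by (auto simp: M_def)
  define c where "c \<xi> j = size {#i \<in># \<xi>. j \<le> i#}" for \<xi> and j :: nat
  have "Max (insert 0 (set_mset (wrap_hook a \<mu>))) = Suc a"
    using assms(1) by (intro Max_eqI) (auto simp: wrap_hook_def split: if_splits)
  then have "conjugate (wrap_hook a \<mu>) = image_mset (c (wrap_hook a \<mu>)) (mset_set {1..Suc a})"
    unfolding conjugate_def columns_eq c_def by simp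
  also have "{1..Suc a} = insert 1 (Suc ` {1..a})"
    using atLeastAtMost_insertL[of 1 "Suc a"] by simp
  also have "image_mset (c (wrap_hook a \<mu>)) (mset_set (insert 1 (Suc ` {1..a}))) =
      add_mset (c (wrap_hook a \<mu>) 1) (image_mset (\<lambda>j. c (wrap_hook a \<mu>) (Suc j)) (mset_set {1..a}))"
    by (subst mset_set.insert)
      (auto simp: image_mset_mset_set[symmetric] multiset.map_comp o_def
        simp del: image_Suc_atLeastAtMost)
  \<comment> \<open>The first column meets every row: one new row, \<open>size \<mu>\<close> old
    ones and \<open>a - size \<mu>\<close> ones.\<close>
  also have "c (wrap_hook a \<mu>) 1 = Suc a"
    using assms(2) by (simp add: c_def wrap_hook_def filter_mset_image_mset filter_mset_replicate_mset)
  \<comment> \<open>Column \<open>Suc j\<close> is column \<open>j\<close> of \<mu> with one cell of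
    the new first row on top; the rows of length 1 do not reach it.\<close>
  also have "image_mset (\<lambda>j. c (wrap_hook a \<mu>) (Suc j)) (mset_set {1..a}) =
      image_mset (\<lambda>j. Suc (c \<mu> j)) (mset_set {1..a})"
    by (intro image_mset_cong) (auto simp: c_def wrap_hook_def filter_mset_image_mset
        filter_mset_replicate_mset)
  \<comment> \<open>Columns up to \<open>M\<close> form the conjugate of \<mu>; those from
    \<open>Suc M\<close> to \<open>a\<close> are empty in \<mu> and yield the padding ones.\<close>
  also have "mset_set {1..a} = mset_set {1..M} + mset_set {Suc M..a}"
    using M(1) by (subst mset_set_Union[symmetric]) (auto intro: arg_cong[where f = mset_set])
  also have "image_mset (\<lambda>j. Suc (c \<mu> j)) (mset_set {1..M} + mset_set {Suc M..a}) =
      image_mset Suc (conjugate \<mu>) + image_mset (\<lambda>j. Suc (c \<mu> j)) (mset_set {Suc M..a})"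
    unfolding conjugate_def columns_eq by (simp add: multiset.map_comp o_def c_def M_def)
  also have "image_mset (\<lambda>j. Suc (c \<mu> j)) (mset_set {Suc M..a}) =
      image_mset (\<lambda>_. 1) (mset_set {Suc M..a})"
    using M(2) by (intro image_mset_cong) (fastforce simp: c_def)
  also have "\<dots> = replicate_mset (a - M) 1"
    by (simp add: image_mset_const_eq)
  finally show ?thesis
    by (simp add: wrap_hook_def size_conjugate M_def)
qed

text \<open>Peeling leaves \<open>a\<close> shortened rows \<rho>. Its zeros come from rows that
  held a leg cell only, and there are \<open>a - size \<xi>\<close> of them, as the definition of
  \<open>wrap_hook\<close> demands.\<close>

lemma wrap_hook_surj:
  assumes "0 \<notin># \<mu>" "Suc a \<in># \<mu>" "size \<mu> = Suc a"
  obtains \<xi> where "\<mu> = wrap_hook a \<xi>" "0 \<notin># \<xi>" "size \<xi> \<le> a"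
proof -
  define \<rho> where "\<rho> = image_mset (\<lambda>i. i - 1) (\<mu> - {#Suc a#})"
  define \<xi> where "\<xi> = filter_mset (\<lambda>i. i \<noteq> 0) \<rho>"
  have size_\<rho>: "size \<rho> = a"
    using assms by (simp add: \<rho>_def size_Diff_singleton)
  have \<rho>: "\<rho> = \<xi> + replicate_mset (count \<rho> 0) 0"
    unfolding \<xi>_def by (rule multiset_eqI) auto
  then have "size \<xi> + count \<rho> 0 = a"
    using size_\<rho> by (metis size_union size_replicate_mset)
  then have size_\<xi>: "count \<rho> 0 = a - size \<xi>" "size \<xi> \<le> a"
    by auto
  have "image_mset Suc \<rho> = image_mset (\<lambda>i. i) (\<mu> - {#Suc a#})"
    unfolding \<rho>_def multiset.map_comp o_def
    using assms(1) by (intro image_mset_cong) (metis Suc_diff_1 in_diffD neq0_conv)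
  then have "\<mu> = add_mset (Suc a) (image_mset Suc \<rho>)"
    using assms(2) by simp
  also have "image_mset Suc \<rho> = image_mset Suc \<xi> + replicate_mset (a - size \<xi>) 1"
    by (subst \<rho>) (simp add: size_\<xi>)
  finally show thesis
    using that[of \<xi>] size_\<xi> by (simp add: wrap_hook_def \<xi>_def)
qed

section \<open>Parallel recursions for self-conjugate partitions and distinct odd parts\<close>

definition self_conjugates_upto :: "nat \<Rightarrow> nat \<Rightarrow> nat multiset set" where
  "self_conjugates_upto a n = {\<mu> \<in> partitions n. conjugate \<mu> = \<mu> \<and> (\<forall>i\<in>#\<mu>. i \<le> a)}"

text \<open>The bound \<open>2 * a\<close> mirrors the bound \<open>a\<close> above: a symmetric
  hook whose first row has at most \<open>a\<close> cells has fewer than \<open>2 * a\<close>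
  cells.\<close>

definition distinct_odds_below :: "nat \<Rightarrow> nat \<Rightarrow> nat multiset set" where
  "distinct_odds_below a n = {\<mu> \<in> partitions n. distinct_parts \<mu> \<and> (\<forall>i\<in>#\<mu>. odd i \<and> i < 2 * a)}"

text \<open>A self-conjugate partition has as many rows as columns, and the number of columns is its
  largest part.\<close>

lemma size_self_conjugate_le:
  assumes "\<mu> \<in> self_conjugates_upto a n"
  shows "size \<mu> \<le> a"
  using assms size_conjugate[of \<mu>] by (auto simp: self_conjugates_upto_def)

text \<open>The cases are whether \<open>Suc a\<close> occurs as a part. The conditional guards
  against truncated subtraction, which would otherwise admit the empty partition when
  \<open>n\<close> is too small for the hook.\<close>

lemma self_conjugates_upto_Suc:
  "self_conjugates_upto (Suc a) n = self_conjugates_upto a n \<union>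
     wrap_hook a ` (if n < 2 * a + 1 then {} else self_conjugates_upto a (n - (2 * a + 1)))"
  (is "?L = ?S \<union> ?R")
proof (intro equalityI subsetI)
  fix \<mu> assume \<mu>: "\<mu> \<in> ?L"
  show "\<mu> \<in> ?S \<union> ?R"
  proof (cases "Suc a \<in># \<mu>")
    case False
    with \<mu> show ?thesis
      by (auto simp: self_conjugates_upto_def le_Suc_eq)
  next
    case True
    have sc: "0 \<notin># \<mu>" "\<Sum>\<^sub># \<mu> = n" "conjugate \<mu> = \<mu>" "\<forall>i\<in>#\<mu>. i \<le> Suc a"
      using \<mu> by (auto simp: self_conjugates_upto_def partitions_def)
    have "Max (insert 0 (set_mset \<mu>)) = Suc a"
      using True sc(4) by (intro Max_eqI) auto
    then have "size \<mu> = Suc a"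
      using size_conjugate[of \<mu>] sc(3) by simp
    with True sc(1) obtain \<xi> where \<xi>: "\<mu> = wrap_hook a \<xi>" "0 \<notin># \<xi>" "size \<xi> \<le> a"
      using wrap_hook_surj by metis
    have le: "\<forall>i\<in>#\<xi>. i \<le> a"
      using sc(4) by (auto simp: \<xi>(1) wrap_hook_def)
    \<comment> \<open>Since wrapping commutes with conjugation, \<xi> and its conjugate wrap to the
      same partition; injectivity applies once both are free of zeros.\<close>
    have "0 \<notin># conjugate \<xi>"
      by (auto simp: conjugate_def columns_eq Max_ge_iff)
    with \<xi> sc(3) have "conjugate \<xi> = \<xi>"
      using conjugate_wrap_hook[OF le \<xi>(3)] wrap_hook_inject by metis
    moreover have "n = \<Sum>\<^sub># \<xi> + (2 * a + 1)"
      using sum_mset_wrap_hook[OF \<xi>(3)] \<xi>(1) sc(2) by simp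
    ultimately have "\<mu> \<in> ?R"
      using \<xi> le by (auto simp: self_conjugates_upto_def partitions_def)
    then show ?thesis ..
  qed
next
  fix \<mu> assume "\<mu> \<in> ?S \<union> ?R"
  then show "\<mu> \<in> ?L"
  proof
    assume "\<mu> \<in> ?S"
    then show ?thesis
      by (auto simp: self_conjugates_upto_def)
  next
    assume "\<mu> \<in> ?R"
    then obtain \<xi> where n: "2 * a + 1 \<le> n" and \<xi>: "\<xi> \<in> self_conjugates_upto a (n - (2 * a + 1))"
      and \<mu>: "\<mu> = wrap_hook a \<xi>"
      by (auto split: if_splits)
    note size = size_self_conjugate_le[OF \<xi>]
    have "conjugate \<mu> = \<mu>"
      using \<xi> conjugate_wrap_hook[OF _ size] by (simp add: self_conjugates_upto_def \<mu>)
    moreover have "\<Sum>\<^sub># \<mu> = n"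
      using \<xi> n sum_mset_wrap_hook[OF size] by (simp add: self_conjugates_upto_def partitions_def \<mu>)
    moreover have "0 \<notin># \<mu>" "\<forall>i\<in>#\<mu>. i \<le> Suc a"
      using \<xi> by (auto simp: self_conjugates_upto_def \<mu> wrap_hook_def split: if_splits)
    ultimately show ?thesis
      by (simp add: self_conjugates_upto_def partitions_def)
  qed
qed

lemma notin_distinct_odds_below:
  assumes "\<mu> \<in> distinct_odds_below a n"
  shows "2 * a + 1 \<notin># \<mu>"
proof -
  have "\<forall>i\<in>#\<mu>. i < 2 * a"
    using assms by (simp add: distinct_odds_below_def)
  then show ?thesis
    by (meson not_add_less1)
qed

lemma distinct_odds_below_Suc:
  "distinct_odds_below (Suc a) n = distinct_odds_below a n \<union>
     add_mset (2 * a + 1) ` (if n < 2 * a + 1 then {} else distinct_odds_below a (n - (2 * a + 1)))"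
  (is "?L = ?S \<union> ?R")
proof (intro equalityI subsetI)
  fix \<mu> assume \<mu>: "\<mu> \<in> ?L"
  \<comment> \<open>The only odd number below \<open>2 * Suc a\<close> but not below
    \<open>2 * a\<close> is \<open>2 * a + 1\<close>.\<close>
  have less: "i < 2 * a" if "i \<in># \<mu>" "i \<noteq> 2 * a + 1" for i
  proof -
    have "odd i" "i < 2 * Suc a"
      using \<mu> that by (auto simp: distinct_odds_below_def)
    with that(2) show ?thesis
      by presburger
  qed
  show "\<mu> \<in> ?S \<union> ?R"
  proof (cases "2 * a + 1 \<in># \<mu>")
    case False
    then have "\<forall>i\<in>#\<mu>. i < 2 * a"
      using less by metis
    with \<mu> show ?thesis
      by (simp add: distinct_odds_below_def)
  next
    case True
    then obtain \<xi> where \<xi>: "\<mu> = add_mset (2 * a + 1) \<xi>"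
      by (metis insert_DiffM)
    have distinct: "count \<mu> i \<le> 1" for i
      using \<mu> by (auto simp: distinct_odds_below_def distinct_parts_def)
    have "2 * a + 1 \<notin># \<xi>"
      using distinct[of "2 * a + 1"] by (simp add: \<xi> not_in_iff)
    moreover have "count \<xi> i \<le> 1" for i
      using distinct[of i] by (simp add: \<xi> split: if_splits)
    ultimately have "\<xi> \<in> distinct_odds_below a (n - (2 * a + 1))" "2 * a + 1 \<le> n"
      using \<mu> less
      by (auto simp: distinct_odds_below_def distinct_parts_def partitions_def \<xi>)
    with \<xi> show ?thesis
      by auto
  qed
next
  fix \<mu> assume "\<mu> \<in> ?S \<union> ?R"
  then show "\<mu> \<in> ?L"
  proof
    assume "\<mu> \<in> ?S"
    then show ?thesis
      by (force simp: distinct_odds_below_def)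
  next
    assume "\<mu> \<in> ?R"
    then obtain \<xi> where n: "2 * a + 1 \<le> n" and \<xi>: "\<xi> \<in> distinct_odds_below a (n - (2 * a + 1))"
      and \<mu>: "\<mu> = add_mset (2 * a + 1) \<xi>"
      by (auto split: if_splits)
    have "distinct_parts \<mu>"
      using \<xi> notin_distinct_odds_below[OF \<xi>] by (simp add: distinct_odds_below_def distinct_parts_def \<mu> not_in_iff)
    moreover have "\<mu> \<in> partitions n"
      using n \<xi> by (simp add: distinct_odds_below_def partitions_def \<mu>)
    moreover have "\<forall>i\<in>#\<mu>. odd i \<and> i < 2 * Suc a"
    proof
      fix i assume "i \<in># \<mu>"
      then consider "i = 2 * a + 1" | "i \<in># \<xi>"
        by (auto simp: \<mu>)
      then show "odd i \<and> i < 2 * Suc a"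
      proof cases
        case 2
        with \<xi> have "odd i" "i < 2 * a"
          by (simp_all add: distinct_odds_below_def)
        then show ?thesis
          by simp
      qed simp
    qed
    ultimately show ?thesis
      by (simp add: distinct_odds_below_def)
  qed
qed

section \<open>Equinumerosity by induction on the bound\<close>

lemma self_conjugates_eqpoll_distinct_odds:
  "self_conjugates_upto a n \<approx> distinct_odds_below a n"
proof (induction a arbitrary: n)
  case 0
  \<comment> \<open>Parts would have to be positive and at most 0, or below 0, so both sets contain
    at most the empty partition.\<close>
  have "\<mu> = {#}" if "\<mu> \<in> self_conjugates_upto 0 n \<union> distinct_odds_below 0 n" for \<mu>
    using that by (cases \<mu>) (auto simp: self_conjugates_upto_def distinct_odds_below_def partitions_def)
  moreover have "{#} \<in> self_conjugates_upto 0 n \<longleftrightarrow> {#} \<in> distinct_odds_below 0 n"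
    by (auto simp: self_conjugates_upto_def distinct_odds_below_def partitions_def conjugate_def
        distinct_parts_def)
  ultimately have "self_conjugates_upto 0 n = distinct_odds_below 0 n"
    by (metis UnCI subset_antisym subsetI)
  then show ?case
    by simp
next
  case (Suc a)
  let ?S = "if n < 2 * a + 1 then {} else self_conjugates_upto a (n - (2 * a + 1))"
  let ?D = "if n < 2 * a + 1 then {} else distinct_odds_below a (n - (2 * a + 1))"
  have "wrap_hook a ` ?S \<approx> ?S"
    by (intro inj_on_image_eqpoll_self inj_onI)
      (auto simp: self_conjugates_upto_def partitions_def split: if_splits dest: wrap_hook_inject)
  also have "?S \<approx> ?D"
    using Suc by simp
  also have "?D \<approx> add_mset (2 * a + 1) ` ?D"
    by (intro eqpoll_sym[OF inj_on_image_eqpoll_self] inj_onI) auto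
  finally have images: "wrap_hook a ` ?S \<approx> add_mset (2 * a + 1) ` ?D" .
  \<comment> \<open>Each union is disjoint, because the images consist of partitions containing the
    new part \<open>Suc a\<close> or \<open>2 * a + 1\<close>, which exceeds the old bound.\<close>
  have "self_conjugates_upto a n \<inter> wrap_hook a ` ?S = {}"
    by (auto simp: self_conjugates_upto_def wrap_hook_def)
  moreover have "distinct_odds_below a n \<inter> add_mset (2 * a + 1) ` ?D = {}"
  proof -
    have "add_mset (2 * a + 1) \<xi> \<notin> distinct_odds_below a n" for \<xi>
      using notin_distinct_odds_below[of "add_mset (2 * a + 1) \<xi>" a n] by force
    then show ?thesis
      by blast
  qed
  ultimately show ?case
    unfolding self_conjugates_upto_Suc distinct_odds_below_Suc
    by (intro Un_eqpoll_cong Suc images) (simp_all only: disjnt_def)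
qed

lemma part_le:
  assumes "\<mu> \<in> partitions n" "i \<in># \<mu>"
  shows "i \<le> n"
  using assms by (auto simp: partitions_def dest!: multi_member_split)

text \<open>No part of a partition of \<open>n\<close> exceeds \<open>n\<close>, so the bounds
  belonging to \<open>Suc n\<close> exclude nothing.\<close>

lemma self_conjugate_partitions_eqpoll:
  "{\<mu> \<in> partitions n. conjugate \<mu> = \<mu>} \<approx>
   {\<mu> \<in> partitions n. distinct_parts \<mu> \<and> (\<forall>i\<in>#\<mu>. odd i)}"
proof -
  have "{\<mu> \<in> partitions n. conjugate \<mu> = \<mu>} = self_conjugates_upto (Suc n) n"
    by (auto simp: self_conjugates_upto_def le_SucI dest: part_le)
  moreover have "{\<mu> \<in> partitions n. distinct_parts \<mu> \<and> (\<forall>i\<in>#\<mu>. odd i)} =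
      distinct_odds_below (Suc n) n"
    by (force simp: distinct_odds_below_def dest: part_le)
  ultimately show ?thesis
    using self_conjugates_eqpoll_distinct_odds by simp
qed

section \<open>Adjoining the distinct even parts\<close>

theorem theorem3:
  fixes n :: nat
  assumes "n \<ge> 1"
  shows "h n = q n"
proof -
  define S where "S k = {\<mu> \<in> partitions k. conjugate \<mu> = \<mu>}" for k
  define O' where "O' k = {\<mu> \<in> partitions k. distinct_parts \<mu> \<and> (\<forall>i\<in>#\<mu>. odd i)}" for k
  define E where "E k = {\<mu> \<in> partitions k. distinct_parts \<mu> \<and> (\<forall>i\<in>#\<mu>. even i)}" for k
  \<comment> \<open>Indexing by the weight \<open>k\<close> of the non-overlined parts makes each
    fibre a product, so that \<open>S k\<close> can be exchanged for \<open>O' k\<close> while the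
    overlined parts stay fixed.\<close>
  have "bij_betw snd (SIGMA k:{..n}. S k \<times> E (n - k)) {\<pi> \<in> D2 n. self_half_conjugate \<pi>}"
    by (rule bij_betwI[where g = "\<lambda>\<pi>. (\<Sum>\<^sub># (fst \<pi>), \<pi>)"])
      (auto simp: S_def E_def D2_def overpartitions_def self_half_conjugate_def partitions_def)
  then have "{\<pi> \<in> D2 n. self_half_conjugate \<pi>} \<approx> (SIGMA k:{..n}. S k \<times> E (n - k))"
    using eqpoll_def eqpoll_sym by blast
  also have "\<dots> \<approx> (SIGMA k:{..n}. O' k \<times> E (n - k))"
    unfolding S_def O'_def
    by (intro Sigma_eqpoll_cong[OF bij_betw_id, unfolded id_apply] times_eqpoll_cong
        self_conjugate_partitions_eqpoll eqpoll_refl)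
  also have "\<dots> \<approx> {\<mu> \<in> partitions n. distinct_parts \<mu>}"
  proof -
    \<comment> \<open>Parity keeps the parts of \<mu> and \<nu> apart: their union has no
      repetition, and filtering by parity recovers both.\<close>
    have join: "\<mu> + \<nu> \<in> partitions n \<and> distinct_parts (\<mu> + \<nu>) \<and>
        filter_mset odd (\<mu> + \<nu>) = \<mu> \<and> filter_mset even (\<mu> + \<nu>) = \<nu>"
      if "k \<le> n" "\<mu> \<in> O' k" "\<nu> \<in> E (n - k)" for k \<mu> \<nu>
    proof -
      have "count \<mu> i + count \<nu> i \<le> 1" for i
        using that by (cases "even i") (auto simp: O'_def E_def distinct_parts_def not_in_iff)
      moreover have "filter_mset odd \<mu> = \<mu>" "filter_mset even \<nu> = \<nu>"
        using that by (auto simp: O'_def E_def filter_mset_eq_conv)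
      moreover have "filter_mset odd \<nu> = {#}" "filter_mset even \<mu> = {#}"
        using that by (auto simp: O'_def E_def)
      ultimately show ?thesis
        using that by (auto simp: O'_def E_def partitions_def distinct_parts_def)
    qed
    have split: "filter_mset odd \<mu> + filter_mset even \<mu> = \<mu>" for \<mu> :: "nat multiset"
      by (metis add.commute multiset_partition)
    have sum_split: "\<Sum>\<^sub># (filter_mset odd \<mu>) + \<Sum>\<^sub># (filter_mset even \<mu>) = \<Sum>\<^sub># \<mu>"
      for \<mu> :: "nat multiset"
      by (metis split sum_mset.union)
    have "bij_betw (\<lambda>(k, \<mu>, \<nu>). \<mu> + \<nu>) (SIGMA k:{..n}. O' k \<times> E (n - k))
        {\<mu> \<in> partitions n. distinct_parts \<mu>}"
    \<comment> \<open>The inverse splits by parity; the index \<open>k\<close> is recovered as the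
      sum of the odd parts.\<close>
    proof (rule bij_betwI[where
          g = "\<lambda>\<mu>. (\<Sum>\<^sub># (filter_mset odd \<mu>), filter_mset odd \<mu>, filter_mset even \<mu>)"])
      show "(\<lambda>\<mu>. (\<Sum>\<^sub># (filter_mset odd \<mu>), filter_mset odd \<mu>, filter_mset even \<mu>))
          \<in> {\<mu> \<in> partitions n. distinct_parts \<mu>} \<rightarrow> (SIGMA k:{..n}. O' k \<times> E (n - k))"
      proof (intro Pi_I)
        fix \<mu> assume "\<mu> \<in> {\<mu> \<in> partitions n. distinct_parts \<mu>}"
        then show "(\<Sum>\<^sub># (filter_mset odd \<mu>), filter_mset odd \<mu>, filter_mset even \<mu>)
            \<in> (SIGMA k:{..n}. O' k \<times> E (n - k))"
          using sum_split[of \<mu>] by (auto simp: O'_def E_def partitions_def distinct_parts_def)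
      qed
    next
      fix x assume "x \<in> (SIGMA k:{..n}. O' k \<times> E (n - k))"
      then obtain k \<mu> \<nu> where "x = (k, \<mu>, \<nu>)" "k \<le> n" "\<mu> \<in> O' k" "\<nu> \<in> E (n - k)"
        by auto
      moreover from this have "\<Sum>\<^sub># \<mu> = k"
        by (simp add: O'_def partitions_def)
      ultimately show "(\<Sum>\<^sub># (filter_mset odd (case x of (k, \<mu>, \<nu>) \<Rightarrow> \<mu> + \<nu>)),
          filter_mset odd (case x of (k, \<mu>, \<nu>) \<Rightarrow> \<mu> + \<nu>),
          filter_mset even (case x of (k, \<mu>, \<nu>) \<Rightarrow> \<mu> + \<nu>)) = x"
        using join by (simp del: filter_union_mset)
    qed (use join split in auto)
    then show ?thesis
      using eqpoll_def by blast
  qed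
  finally show ?thesis
    unfolding h_def q_def by (auto simp: eqpoll_def intro: bij_betw_same_card)
qed

end
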